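(* Let $n,k$ be positive integers with $n>k$. Let $\mathcal{S}$ be an $n$-element subset of $\mathbb{E}^k$ whose points are not all contained in any $(k-1)$-dimensional hyperplane (affine subspace of dimension $k-1$). If the points of $\mathbb{E}^k$ are colored in finitely many colors (i.e. $\chi:\mathbb{E}^k\to\{1,\ldots,c\}$ is an arbitrary function for some positive integer $c$), then there exists a set of $2^{\aleph_0}$ positive real numbers $r$ such that for each such $r$ there exists a family of cardinality $2^{\aleph_0}$ of pairwise-disjoint monochromatic subsets of $\mathbb{E}^k$, each homothetic to $\mathcal{S}$ with dilation factor $r$.
   Context: $\mathbb{E}^k$ denotes $k$-dimensional Euclidean space (i.e. $\mathbb{R}^k$). For $\mathcal{X}\subseteq\mathbb{E}^k$, $r\in\mathbb{R}$ and $\mathbf{a}\in\mathbb{E}^k$, $\mathbf{a}+r\mathcal{X}=\{\mathbf{a}+r\mathbf{x}:\mathbf{x}\in\mathcal{X}\}$. A subset of $\mathbb{E}^k$ is homothetic to $\mathcal{S}$ with dilation factor $r>0$ if it is of the form $\mathbf{a}+r\mathcal{S}$ for some $\mathbf{a}\in\mathbb{E}^k$. A set is monochromatic if all its points receive the same color. *)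

theory Defs
  imports "HOL-Analysis.Analysis" "HOL-Library.Equipollence"
begin

definition homothetic_with :: "real \<Rightarrow> 'a::real_vector set \<Rightarrow> 'a set \<Rightarrow> bool" where
  "homothetic_with r S T \<longleftrightarrow> 0 < r \<and> (\<exists>a. T = (\<lambda>x. a + r *\<^sub>R x) ` S)"

text \<open>Cardinality exactly \<open>2\<close> to the power aleph-null, taken literally as that of the powerset
  of the natural numbers.\<close>

definition continuum_many :: "'a set \<Rightarrow> bool" where
  "continuum_many A \<longleftrightarrow> A \<approx> (UNIV :: nat set set)"

end

theory Submission
  imports Defs
begin

text \<open>Gallai's theorem, by colour focusing, gives finitely many pairs \<open>(a, d)\<close> such that every
  colouring of the space makes one of the sets \<open>a + d S\<close> monochromatic. Transporting the colouring
  by \<open>x \<mapsto> v + t x\<close> gives, for every \<open>t > 0\<close> and every \<open>v\<close>, a monochromatic homothet of \<open>S\<close> in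
  \<open>v + t W\<close> with dilation factor in \<open>t D\<close>, where \<open>W\<close> and \<open>D\<close> are finite. Short distinct vectors
  \<open>v\<close> on a line give disjoint translates of \<open>t W\<close>, so by the pigeonhole principle some factor in
  \<open>t D\<close> is attained by continuum many disjoint homothets. Thus the set of good factors meets
  \<open>t D\<close> for all \<open>t > 0\<close>; finitely many dilates of it cover the interval \<open>(0, 1)\<close>.\<close>

section \<open>Gallai's theorem\<close>

definition mono_homothet :: "('a::real_vector \<Rightarrow> 'b) \<Rightarrow> 'a set \<Rightarrow> 'a \<Rightarrow> real \<Rightarrow> bool" where
  "mono_homothet \<kappa> S a d \<longleftrightarrow> (\<exists>q. \<forall>s\<in>S. \<kappa> (a + d *\<^sub>R s) = q)"

text \<open>The centres and factors are confined to finite sets that depend on the number of colours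
  but not on the colouring. This uniformity makes it possible to colour points by whole finite
  patterns later on.\<close>

definition gallai :: "'a::real_vector set \<Rightarrow> bool" where
  "gallai S \<longleftrightarrow> (\<forall>c. \<exists>A D. finite A \<and> finite D \<and> D \<subseteq> {0<..} \<and>
     (\<forall>\<kappa>. (\<forall>x. \<kappa> x < (c::nat)) \<longrightarrow>
        (\<exists>a\<in>A. \<exists>d\<in>D. mono_homothet \<kappa> S a d)))"

text \<open>An injective numbering of the colours reduces this to colours below a natural number.
  Focusing needs it because there the colours are functions.\<close>

lemma gallai_finite_range:
  fixes S :: "'a::real_vector set" and C :: "'b set"
  assumes "gallai S" "finite C"
  shows "\<exists>A D. finite A \<and> finite D \<and> D \<subseteq> {0<..} \<and>
     (\<forall>\<kappa>. (\<forall>x. \<kappa> x \<in> C) \<longrightarrow> (\<exists>a\<in>A. \<exists>d\<in>D. mono_homothet \<kappa> S a d))"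
proof -
  obtain h and c :: nat where h: "h ` C = {i. i < c}" "inj_on h C"
    using finite_imp_inj_to_nat_seg[OF assms(2)] by blast
  obtain A D where AD: "finite A" "finite D" "D \<subseteq> {0<..}"
    "\<forall>\<kappa>. (\<forall>x. \<kappa> x < c) \<longrightarrow> (\<exists>a\<in>A. \<exists>d\<in>D. mono_homothet \<kappa> S a d)"
    using assms(1)[unfolded gallai_def, rule_format, of c] by blast
  have "\<exists>a\<in>A. \<exists>d\<in>D. mono_homothet \<kappa> S a d" if "\<forall>x. \<kappa> x \<in> C" for \<kappa>
  proof -
    from that have \<kappa>: "\<kappa> x \<in> C" for x by blast
    have "(h \<circ> \<kappa>) x < c" for x using h(1) \<kappa>[of x] by auto
    then obtain a d where ad: "a \<in> A" "d \<in> D" "mono_homothet (h \<circ> \<kappa>) S a d"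
      using AD(4)[rule_format, of "h \<circ> \<kappa>"] by blast
    then obtain q where q: "\<And>s. s \<in> S \<Longrightarrow> h (\<kappa> (a + d *\<^sub>R s)) = q"
      by (auto simp: mono_homothet_def)
    have "\<kappa> (a + d *\<^sub>R s) = inv_into C h q" if "s \<in> S" for s
      using inv_into_f_f[OF h(2) \<kappa>] q[OF that] by metis
    then have "mono_homothet \<kappa> S a d" by (auto simp: mono_homothet_def)
    with ad show ?thesis by blast
  qed
  then show ?thesis
    by (intro exI[of _ A] exI[of _ D] conjI allI impI AD(1-3))
qed

text \<open>Since \<open>(a - d *\<^sub>R t) + d *\<^sub>R (t + s) = a + d *\<^sub>R s\<close>, only
  the centres change and the factors stay.\<close>

lemma gallai_translation:
  fixes S :: "'a::real_vector set"
  assumes "gallai S"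
  shows "gallai ((+) t ` S)"
  unfolding gallai_def
proof
  fix c :: nat
  obtain A D where AD: "finite A" "finite D" "D \<subseteq> {0<..}"
    "\<forall>\<kappa>. (\<forall>x. \<kappa> x < c) \<longrightarrow> (\<exists>a\<in>A. \<exists>d\<in>D. mono_homothet \<kappa> S a d)"
    using assms[unfolded gallai_def, rule_format, of c] by blast
  let ?A = "(\<lambda>(a, d). a - d *\<^sub>R t) ` (A \<times> D)"
  have "\<exists>a\<in>?A. \<exists>d\<in>D. mono_homothet \<kappa> ((+) t ` S) a d"
    if \<kappa>: "\<forall>x. \<kappa> x < c" for \<kappa>
  proof -
    obtain a d where ad: "a \<in> A" "d \<in> D" and const: "mono_homothet \<kappa> S a d"
      using AD(4) \<kappa> by blast
    have "mono_homothet \<kappa> ((+) t ` S) (a - d *\<^sub>R t) d"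
      using const by (auto simp: mono_homothet_def scaleR_right_distrib)
    moreover have "a - d *\<^sub>R t \<in> ?A" using ad by force
    ultimately show ?thesis using ad(2) by blast
  qed
  moreover have "finite ?A" using AD by simp
  ultimately
  show "\<exists>A D. finite A \<and> finite D \<and> D \<subseteq> {0<..} \<and>
     (\<forall>\<kappa>. (\<forall>x. \<kappa> x < c) \<longrightarrow>
        (\<exists>a\<in>A. \<exists>d\<in>D. mono_homothet \<kappa> ((+) t ` S) a d))"
    by (intro exI[of _ ?A] exI[of _ D] conjI allI impI AD(2,3))
qed

text \<open>Here \<open>C\<close> is a set of \<open>m\<close> colours of homothets of \<open>S\<close> that are focused at \<open>a\<close>.\<close>

lemma colour_focusing:
  fixes S :: "'a::real_vector set"
  assumes S: "gallai S" "finite S" "S \<noteq> {}"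
  shows "\<exists>A D. finite A \<and> finite D \<and> D \<subseteq> {0<..} \<and>
     (\<forall>\<kappa>. (\<forall>x. \<kappa> x < (c::nat)) \<longrightarrow>
        (\<exists>a\<in>A. \<exists>d\<in>D. mono_homothet \<kappa> (insert 0 S) a d) \<or>
        (\<exists>a\<in>A. \<exists>C\<subseteq>{..<c}. card C = m \<and> (\<forall>q\<in>C. \<exists>d\<in>D. \<forall>s\<in>S. \<kappa> (a + d *\<^sub>R s) = q)))"
proof (induction m)
  case 0
  show ?case
    \<comment> \<open>The empty set of colours is focused at any point, so any centre and positive
      factor will do.\<close>
    by (rule exI[of _ "{0}"], rule exI[of _ "{1}"]) force
next
  case (Suc m)
  then obtain A D where fin: "finite A" "finite D" and pos: "D \<subseteq> {0<..}" and
    foc: "\<forall>\<kappa>. (\<forall>x. \<kappa> x < c) \<longrightarrow>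
        (\<exists>a\<in>A. \<exists>d\<in>D. mono_homothet \<kappa> (insert 0 S) a d) \<or>
        (\<exists>a\<in>A. \<exists>C\<subseteq>{..<c}. card C = m \<and> (\<forall>q\<in>C. \<exists>d\<in>D. \<forall>s\<in>S. \<kappa> (a + d *\<^sub>R s) = q))"
    by blast
  \<comment> \<open>\<open>W\<close> collects all points whose colours the induction hypothesis
    inspects: the foci and the points of the homothets around them.\<close>
  define W where "W = A \<union> (\<lambda>(a, d, s). a + d *\<^sub>R s) ` (A \<times> D \<times> S)"
  have W: "a \<in> W" "d \<in> D \<Longrightarrow> s \<in> S \<Longrightarrow> a + d *\<^sub>R s \<in> W" if "a \<in> A" for a d s
    using that unfolding W_def by force+
  have "finite W" unfolding W_def using fin S(2) by simp
  \<comment> \<open>These are the colour patterns on \<open>W\<close>; taking extensional functions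
    keeps their number finite.\<close>
  define P where "P = W \<rightarrow>\<^sub>E {..<c}"
  have "finite P" unfolding P_def using \<open>finite W\<close> by (intro finite_PiE) auto
  from gallai_finite_range[OF S(1) this] obtain A' D' where
    fin': "finite A'" "finite D'" and pos': "D' \<subseteq> {0<..}" and
    gal: "\<forall>\<kappa>. (\<forall>x. \<kappa> x \<in> P) \<longrightarrow>
       (\<exists>a\<in>A'. \<exists>d\<in>D'. mono_homothet \<kappa> S a d)"
    by (elim exE conjE) (rule that)
  obtain s0 where s0: "s0 \<in> S" using S(3) by blast
  \<comment> \<open>The points \<open>a' + a\<close> serve as new foci, with factors
    \<open>d'\<close> and \<open>d' + d\<close>. The points \<open>a' + d' *\<^sub>R s0 + a\<close>
    serve as centres of monochromatic homothets of \<open>insert 0 S\<close>, with the old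
    factors.\<close>
  define A'' where "A'' = (\<lambda>(a', a). a' + a) ` (A' \<times> A)
     \<union> (\<lambda>(a', d', a). a' + d' *\<^sub>R s0 + a) ` (A' \<times> D' \<times> A)"
  define D'' where "D'' = D \<union> D' \<union> (\<lambda>(d', d). d' + d) ` (D' \<times> D)"
  have A'': "a' + a \<in> A''" "d' \<in> D' \<Longrightarrow> a' + d' *\<^sub>R s0 + a \<in> A''"
    if "a' \<in> A'" "a \<in> A" for a' a d'
    using that unfolding A''_def by force+
  have D'': "d \<in> D \<Longrightarrow> d \<in> D''" "d' \<in> D' \<Longrightarrow> d' \<in> D''"
    "d' \<in> D' \<Longrightarrow> d \<in> D \<Longrightarrow> d' + d \<in> D''" for d d'
    unfolding D''_def by force+
  have fin'': "finite A''" "finite D''" and pos'': "D'' \<subseteq> {0<..}"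
    using fin fin' pos pos' unfolding A''_def D''_def by (auto intro!: add_pos_pos)
  have "(\<exists>a\<in>A''. \<exists>d\<in>D''. mono_homothet \<kappa> (insert 0 S) a d) \<or>
        (\<exists>a\<in>A''. \<exists>C\<subseteq>{..<c}. card C = Suc m \<and> (\<forall>q\<in>C. \<exists>d\<in>D''. \<forall>s\<in>S. \<kappa> (a + d *\<^sub>R s) = q))"
    if "\<forall>x. \<kappa> x < c" for \<kappa>
  proof -
    from that have \<kappa>: "\<kappa> x < c" for x by blast
    define \<phi> where "\<phi> x = (\<lambda>w\<in>W. \<kappa> (x + w))" for x
    have "\<phi> x \<in> P" for x unfolding \<phi>_def P_def using \<kappa> by auto
    then obtain a' d' where a': "a' \<in> A'" and d': "d' \<in> D'"
      and const: "mono_homothet \<phi> S a' d'"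
      using gal[rule_format, of \<phi>] by blast
    define b where "b = a' + d' *\<^sub>R s0"
    \<comment> \<open>The translates of \<open>W\<close> by the points
      \<open>a' + d' *\<^sub>R s\<close> all carry the same pattern, and \<open>b\<close> is one of
      these points.\<close>
    have same: "\<kappa> (a' + d' *\<^sub>R s + w) = \<kappa> (b + w)" if "s \<in> S" "w \<in> W" for s w
    proof -
      have "\<phi> (a' + d' *\<^sub>R s) = \<phi> b"
        using const s0 that(1) unfolding b_def mono_homothet_def by metis
      from fun_cong[OF this, of w] show ?thesis using that(2) by (simp add: \<phi>_def)
    qed
    \<comment> \<open>This is the induction hypothesis, applied to the colouring shifted by
      \<open>b\<close>.\<close>
    consider
        (mono) a d where "a \<in> A" "d \<in> D"
          "mono_homothet (\<lambda>x. \<kappa> (b + x)) (insert 0 S) a d"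
      | (focused) a C where "a \<in> A" "C \<subseteq> {..<c}" "card C = m"
          "\<forall>q\<in>C. \<exists>d\<in>D. \<forall>s\<in>S. \<kappa> (b + (a + d *\<^sub>R s)) = q"
      using foc[rule_format, of "\<lambda>x. \<kappa> (b + x)"] \<kappa> by blast
    then show ?thesis
    proof cases
      case mono
      then have "mono_homothet \<kappa> (insert 0 S) (b + a) d"
        by (simp add: mono_homothet_def add.assoc)
      moreover have "b + a \<in> A''" unfolding b_def by (rule A''(2)) fact+
      ultimately show ?thesis using D''(1)[OF mono(2)] by blast
    next
      case focused
      show ?thesis
      \<comment> \<open>If the focus repeats a colour of \<open>C\<close>, it completes the homothet
        of that colour. Otherwise its own colour is gained.\<close>
      proof (cases "\<kappa> (b + a) \<in> C")
        case True
        then obtain d where d: "d \<in> D" "\<forall>s\<in>S. \<kappa> (b + (a + d *\<^sub>R s)) = \<kappa> (b + a)"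
          using focused(4) by blast
        have "mono_homothet \<kappa> (insert 0 S) (b + a) d"
          using d(2) unfolding mono_homothet_def by (auto simp: add.assoc)
        moreover have "b + a \<in> A''" unfolding b_def by (rule A''(2)) fact+
        ultimately show ?thesis using D''(1)[OF d(1)] by blast
      next
        case False
        let ?C = "insert (\<kappa> (b + a)) C"
        have "finite C" using focused(2) finite_subset by blast
        then have C: "?C \<subseteq> {..<c}" "card ?C = Suc m"
          using focused(2,3) \<kappa> False by auto
        \<comment> \<open>The focus moves to \<open>a' + a\<close>. Factor \<open>d'\<close> gives
          the translates of the old focus, which have the new colour. Factor \<open>d' + d\<close>
          gives the points \<open>(a' + d' *\<^sub>R s) + (a + d *\<^sub>R s)\<close>, which by
          \<open>same\<close> keep the old colour \<open>q\<close>.\<close>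
        have "\<exists>d\<in>D''. \<forall>s\<in>S. \<kappa> ((a' + a) + d *\<^sub>R s) = q" if "q \<in> ?C" for q
        proof (cases "q = \<kappa> (b + a)")
          case True
          have "\<kappa> ((a' + a) + d' *\<^sub>R s) = q" if "s \<in> S" for s
            using same[OF that W(1)[OF focused(1)]] True by (simp add: algebra_simps)
          then show ?thesis using D''(2)[OF d'] by blast
        next
          case False
          then obtain d where d: "d \<in> D" "\<forall>s\<in>S. \<kappa> (b + (a + d *\<^sub>R s)) = q"
            using focused(4) \<open>q \<in> ?C\<close> by blast
          have "\<kappa> ((a' + a) + (d' + d) *\<^sub>R s) = q" if "s \<in> S" for s
            using same[OF that W(2)[OF focused(1) d(1) that]] d(2) that
            by (simp add: algebra_simps)
          then show ?thesis using D''(3)[OF d' d(1)] by blast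
        qed
        then show ?thesis using C A''(1)[OF a' focused(1)] by blast
      qed
    qed
  qed
  then show ?case by (intro exI[of _ A''] exI[of _ D''] conjI allI impI fin'' pos'')
qed

text \<open>With only \<open>c\<close> colours, \<open>Suc c\<close> distinct ones cannot be
  focused, so focusing must end in a monochromatic homothet.\<close>

lemma gallai_insert_zero:
  fixes S :: "'a::real_vector set"
  assumes "gallai S" "finite S" "S \<noteq> {}"
  shows "gallai (insert 0 S)"
  unfolding gallai_def
proof
  fix c :: nat
  have no: "\<not> (C \<subseteq> {..<c} \<and> card C = Suc c)" for C
    using card_mono[of "{..<c}" C] by auto
  show "\<exists>A D. finite A \<and> finite D \<and> D \<subseteq> {0<..} \<and>
     (\<forall>\<kappa>. (\<forall>x. \<kappa> x < c) \<longrightarrow>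
        (\<exists>a\<in>A. \<exists>d\<in>D. mono_homothet \<kappa> (insert 0 S) a d))"
    using colour_focusing[OF assms, of c "Suc c"] no by meson
qed

text \<open>Points are added one at a time: a translation moves the new point to the origin, where
  it can be inserted by focusing, and the inverse translation moves it back.\<close>

theorem gallai:
  fixes S :: "'a::real_vector set"
  assumes "finite S" "S \<noteq> {}"
  shows "gallai S"
  using assms
proof (induction S rule: finite_ne_induct)
  case (singleton x)
  show ?case
    unfolding gallai_def
    by (intro allI exI[of _ "{0}"] exI[of _ "{1}"]) (auto simp: mono_homothet_def)
next
  case (insert x F)
  have "gallai (insert 0 ((+) (-x) ` F))"
    using insert by (intro gallai_insert_zero gallai_translation) auto
  then have "gallai ((+) x ` insert 0 ((+) (-x) ` F))" by (rule gallai_translation)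
  then show ?case by (simp add: image_image)
qed

section \<open>Continuum many homothets\<close>

text \<open>Two sets of cardinality strictly below that of an infinite set have a union strictly
  below it; induction extends this to finite unions.\<close>

lemma infinite_finite_UN_lepoll:
  includes cardinal_syntax
  assumes "finite I" "infinite X" "X \<lesssim> (\<Union>i\<in>I. A i)"
  shows "\<exists>i\<in>I. X \<lesssim> A i"
proof (rule ccontr)
  \<comment> \<open>Comparability of cardinals turns failure of an embedding into a strict
    inequality.\<close>
  have le: "X \<lesssim> Y \<longleftrightarrow> \<not> |Y| <o |X|" for Y :: "'c set"
    unfolding lepoll_def card_of_ordLeq by (simp add: not_ordLess_iff_ordLeq card_of_Well_order)
  assume "\<not> ?thesis"
  then have less: "|A i| <o |X|" if "i \<in> I" for i using le that by blast
  from \<open>finite I\<close> less have "|\<Union>i\<in>I. A i| <o |X|"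
  proof (induction I)
    case empty
    then show ?case using \<open>infinite X\<close> le[of "{}"] by auto
  next
    case (insert i I)
    then show ?case using card_of_Un_ordLess_infinite[OF \<open>infinite X\<close>, of "A i"] by simp
  qed
  then show False using le assms(3) by blast
qed

lemma continuum_many_real_iff: "continuum_many A \<longleftrightarrow> A \<approx> (UNIV :: real set)"
  unfolding continuum_many_def
  using eqpoll_trans[OF _ nat_sets_eqpoll_reals] eqpoll_trans[OF _ eqpoll_sym[OF nat_sets_eqpoll_reals]]
  by (rule iffI)

text \<open>The interval is equipollent to the reals, so some piece is at least as large; as a set
  of reals it is no larger.\<close>

lemma continuum_many_pigeonhole:
  fixes A :: "'i \<Rightarrow> real set"
  assumes "finite I" "a < b" "{a<..<b} \<subseteq> (\<Union>i\<in>I. A i)"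
  shows "\<exists>i\<in>I. continuum_many (A i)"
proof -
  have "(UNIV :: real set) \<lesssim> {a<..<b}"
    using open_interval_eqpoll_reals[of a b] assms(2) eqpoll_sym eqpoll_imp_lepoll by blast
  also have "\<dots> \<lesssim> (\<Union>i\<in>I. A i)"
    using assms(3) by (rule subset_imp_lepoll)
  finally obtain i where "i \<in> I" "(UNIV :: real set) \<lesssim> A i"
    using infinite_finite_UN_lepoll[OF assms(1) infinite_UNIV_char_0] by blast
  then show ?thesis
    using subset_imp_lepoll[OF subset_UNIV[of "A i"]] lepoll_antisym
    unfolding continuum_many_real_iff by blast
qed

text \<open>The finitely many nonzero differences stay away from 0. This keeps translates of
  \<open>W\<close> by short distinct vectors disjoint.\<close>

lemma finite_differences_gap:
  fixes W :: "'a::real_normed_vector set"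
  assumes "finite W"
  obtains \<epsilon> where "\<epsilon> > 0" "\<And>w w'. w \<in> W \<Longrightarrow> w' \<in> W \<Longrightarrow> norm (w - w') < \<epsilon> \<Longrightarrow> w = w'"
proof -
  define V where "V = (\<lambda>(w, w'). w - w') ` (W \<times> W)"
  have "finite V" unfolding V_def using assms by simp
  from finite_set_avoid[OF this, of 0] obtain \<epsilon> where "\<epsilon> > 0"
    and \<epsilon>: "\<forall>x\<in>V. x \<noteq> 0 \<longrightarrow> \<epsilon> \<le> dist 0 x" by blast
  show thesis
  proof (rule that[OF \<open>\<epsilon> > 0\<close>])
    fix w w' assume w: "w \<in> W" "w' \<in> W" "norm (w - w') < \<epsilon>"
    then have "w - w' \<in> V" unfolding V_def by force
    from bspec[OF \<epsilon> this] w(3) show "w = w'" by auto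
  qed
qed

definition rich_factor :: "('a::real_vector \<Rightarrow> nat) \<Rightarrow> 'a set \<Rightarrow> real \<Rightarrow> bool" where
  "rich_factor \<kappa> S r \<longleftrightarrow> (\<exists>\<F>. continuum_many \<F> \<and> disjoint \<F> \<and>
      (\<forall>T\<in>\<F>. \<kappa> constant_on T \<and> homothetic_with r S T))"

lemma rich_factor_in_dilate:
  fixes S A :: "'a::real_normed_vector set" and e :: 'a and \<kappa> :: "'a \<Rightarrow> nat"
  assumes S: "finite S" "S \<noteq> {}" and e: "norm e = 1"
    and AD: "finite A" "finite D" "D \<subseteq> {0<..}"
    and gal: "\<And>v t. \<exists>a\<in>A. \<exists>d\<in>D. mono_homothet (\<lambda>x. \<kappa> (v + t *\<^sub>R x)) S a d"
    and t: "t > 0"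
  shows "\<exists>d\<in>D. rich_factor \<kappa> S (t * d)"
proof -
  define W where "W = (\<lambda>(a, d, s). a + d *\<^sub>R s) ` (A \<times> D \<times> S)"
  have "finite W" unfolding W_def using AD S by simp
  then obtain \<epsilon> where \<epsilon>: "\<epsilon> > 0"
    "\<And>w w'. w \<in> W \<Longrightarrow> w' \<in> W \<Longrightarrow> norm (w - w') < \<epsilon> \<Longrightarrow> w = w'"
    using finite_differences_gap by blast
  have "\<forall>u. \<exists>a d. a \<in> A \<and> d \<in> D \<and> mono_homothet (\<lambda>x. \<kappa> ((t * u) *\<^sub>R e + t *\<^sub>R x)) S a d"
    using gal by blast
  then obtain \<alpha> \<delta> where \<alpha>: "\<And>u. \<alpha> u \<in> A" and \<delta>: "\<And>u. \<delta> u \<in> D"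
    and const: "\<And>u. mono_homothet (\<lambda>x. \<kappa> ((t * u) *\<^sub>R e + t *\<^sub>R x)) S (\<alpha> u) (\<delta> u)"
    by metis
  define H where "H u = (\<lambda>s. (t * u) *\<^sub>R e + t *\<^sub>R (\<alpha> u + \<delta> u *\<^sub>R s)) ` S" for u
  \<comment> \<open>After division by \<open>t\<close>, a common point gives
    \<open>w - w' = (u' - u) *\<^sub>R e\<close> with norm below \<epsilon>. The gap forces
    \<open>w = w'\<close>, hence \<open>u = u'\<close>.\<close>
  have disj: "H u \<inter> H u' = {}" if "u \<in> {0<..<\<epsilon>}" "u' \<in> {0<..<\<epsilon>}" "u \<noteq> u'" for u u'
  proof (rule ccontr)
    assume "H u \<inter> H u' \<noteq> {}"
    then obtain s s' where s: "s \<in> S" "s' \<in> S" and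
      eq: "(t * u) *\<^sub>R e + t *\<^sub>R (\<alpha> u + \<delta> u *\<^sub>R s) = (t * u') *\<^sub>R e + t *\<^sub>R (\<alpha> u' + \<delta> u' *\<^sub>R s')"
      unfolding H_def by blast
    define w w' where "w = \<alpha> u + \<delta> u *\<^sub>R s" and "w' = \<alpha> u' + \<delta> u' *\<^sub>R s'"
    have "w \<in> W" "w' \<in> W" unfolding W_def w_def w'_def using s \<alpha> \<delta> by force+
    have "t *\<^sub>R (u *\<^sub>R e + w) = t *\<^sub>R (u' *\<^sub>R e + w')"
      using eq by (simp add: w_def w'_def scaleR_right_distrib)
    then have "u *\<^sub>R e + w = u' *\<^sub>R e + w'" using t by simp
    then have diff: "w - w' = (u' - u) *\<^sub>R e" by (simp add: algebra_simps)
    then have "norm (w - w') = \<bar>u' - u\<bar>" using e by simp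
    also have "\<dots> < \<epsilon>" using that by auto
    finally have "w = w'" using \<epsilon>(2) \<open>w \<in> W\<close> \<open>w' \<in> W\<close> by blast
    then show False using diff e that(3) by auto
  qed
  \<comment> \<open>Equal images would be disjoint from themselves, although \<open>S\<close> is
    nonempty.\<close>
  have inj: "inj_on H {0<..<\<epsilon>}"
  proof (rule inj_onI)
    fix u u' assume u: "u \<in> {0<..<\<epsilon>}" "u' \<in> {0<..<\<epsilon>}" "H u = H u'"
    then show "u = u'" using disj[OF u(1,2)] S(2) by (auto simp: H_def)
  qed
  \<comment> \<open>The selected factor splits the interval of parameters into finitely many
    classes.\<close>
  have "\<exists>d\<in>D. continuum_many {u \<in> {0<..<\<epsilon>}. \<delta> u = d}"
    by (rule continuum_many_pigeonhole[OF AD(2) \<epsilon>(1)]) (use \<delta> in blast)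
  then obtain d where d: "d \<in> D" and many: "continuum_many {u \<in> {0<..<\<epsilon>}. \<delta> u = d}" ..
  let ?U = "{u \<in> {0<..<\<epsilon>}. \<delta> u = d}"
  have "inj_on H ?U" using inj by (rule inj_on_subset) auto
  then have "continuum_many (H ` ?U)"
    using many unfolding continuum_many_def by simp
  moreover have "disjoint (H ` ?U)"
    using disj by (auto simp: disjoint_def)
  moreover have "\<kappa> constant_on H u \<and> homothetic_with (t * d) S (H u)" if "u \<in> ?U" for u
  proof
    show "\<kappa> constant_on H u"
      using const[of u] S(2) unfolding constant_on_def mono_homothet_def H_def by auto
    have "H u = (\<lambda>x. ((t * u) *\<^sub>R e + t *\<^sub>R \<alpha> u) + (t * d) *\<^sub>R x) ` S"
      using that unfolding H_def by (auto simp: algebra_simps)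
    then show "homothetic_with (t * d) S (H u)"
      using t d AD(3) unfolding homothetic_with_def by (auto intro!: mult_pos_pos)
  qed
  ultimately show ?thesis
    unfolding rich_factor_def using d by blast
qed

theorem theorem2p4:
  fixes S :: "(real ^ 'k) set" and n c :: nat and \<kappa> :: "real ^ 'k \<Rightarrow> nat"
  assumes "n > CARD('k)"
    and "finite S" and "card S = n"
    and "\<not> (\<exists>H. affine H \<and> aff_dim H = int CARD('k) - 1 \<and> S \<subseteq> H)"
    and "c > 0" and "\<And>x. \<kappa> x \<in> {1..c}"
  shows "\<exists>R :: real set. R \<subseteq> {0<..} \<and> continuum_many R \<and>
    (\<forall>r\<in>R. \<exists>\<F> :: (real ^ 'k) set set. continuum_many \<F> \<and> disjoint \<F> \<and>
      (\<forall>T\<in>\<F>. \<kappa> constant_on T \<and> homothetic_with r S T))"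
proof -
  have "S \<noteq> {}" using assms(1,3) by auto
  obtain A D where AD: "finite A" "finite D" "D \<subseteq> {0<..}" and
    \<comment> \<open>The colours run from 1 to \<open>c\<close>, hence lie below
      \<open>Suc c\<close>.\<close>
    gal: "\<forall>\<phi>. (\<forall>x. \<phi> x < Suc c) \<longrightarrow> (\<exists>a\<in>A. \<exists>d\<in>D. mono_homothet \<phi> S a d)"
    using gallai[OF \<open>finite S\<close> \<open>S \<noteq> {}\<close>, unfolded gallai_def, rule_format, of "Suc c"]
    by (elim exE conjE) (rule that)
  have \<kappa>: "\<kappa> x < Suc c" for x using assms(6)[of x] by auto
  obtain e :: "real ^ 'k" where e: "norm e = 1" using vector_choose_size[of 1] by auto
  define R where "R = {r. 0 < r \<and> rich_factor \<kappa> S r}"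
  have rich: "\<exists>d\<in>D. rich_factor \<kappa> S (t * d)" if "t > 0" for t
    using gal \<kappa> by (intro rich_factor_in_dilate[OF \<open>finite S\<close> \<open>S \<noteq> {}\<close> e AD _ that]) simp
  \<comment> \<open>Each \<open>t\<close> equals \<open>(t * d) / d\<close> for some
    \<open>t * d\<close> in \<open>R\<close>. One of the finitely many dilates of \<open>R\<close>
    thus has the size of the continuum, and so does \<open>R\<close>, since division by
    \<open>d\<close> is injective.\<close>
  have "{0<..<1} \<subseteq> (\<Union>d\<in>D. (\<lambda>r. r / d) ` R)"
  proof
    fix t :: real assume "t \<in> {0<..<1}"
    then have "t > 0" by simp
    then obtain d where d: "d \<in> D" "rich_factor \<kappa> S (t * d)" using rich by blast
    moreover have "d > 0" using d(1) AD(3) by auto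
    ultimately have "t * d \<in> R" "t = (t * d) / d" using \<open>t > 0\<close> by (auto simp: R_def)
    then show "t \<in> (\<Union>d\<in>D. (\<lambda>r. r / d) ` R)" using d(1) by blast
  qed
  then have "\<exists>d\<in>D. continuum_many ((\<lambda>r. r / d) ` R)"
    by (rule continuum_many_pigeonhole[OF AD(2) zero_less_one])
  then obtain d where d: "d \<in> D" "continuum_many ((\<lambda>r. r / d) ` R)" ..
  have "d \<noteq> 0" using d(1) AD(3) by auto
  then have "inj_on (\<lambda>r. r / d) R" by (simp add: inj_on_def)
  then have "continuum_many R" using d(2) unfolding continuum_many_def by simp
  moreover have "R \<subseteq> {0<..}" by (auto simp: R_def)
  ultimately show ?thesis by (intro exI[of _ R]) (auto simp: R_def rich_factor_def)
qed

end
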